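(* Let $n\geq 2$, and let $B_1$ and $B_2$ be two balls in $\mathbb{R}^n$ with positive radii $r_1$ and $r_2$ and centers at distance $d$ apart, where \[ |r_1-r_2|<d<r_1+r_2. \] Then \[ |B_1\cap B_2|=\frac{2^n\pi^{(n-1)/2}}{\Gamma((n+1)/2)}\left[r_1^n\,\mathrm{B}\!\left(\frac{n+1}{2},\frac{n+1}{2};\frac12\Bigl(1-\frac{h_1}{r_1}\Bigr)\right)+r_2^n\,\mathrm{B}\!\left(\frac{n+1}{2},\frac{n+1}{2};\frac12\Bigl(1-\frac{h_2}{r_2}\Bigr)\right)\right], \] where \[ h_1=\frac{r_1^2-r_2^2+d^2}{2d},\qquad h_2=\frac{r_2^2-r_1^2+d^2}{2d}. \] Moreover $-r_j<h_j<r_j$ for $j=1,2$, so both third arguments of the incomplete beta function lie in $(0,1)$.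
   Context: Balls are open Euclidean balls $B(x,r)=\{y\in\mathbb{R}^n:\|x-y\|<r\}$. $|E|$ denotes the $n$-dimensional Lebesgue measure of $E$. $\Gamma$ is the gamma function. The (non-regularized) incomplete beta function is $\mathrm{B}(a,b;z)=\int_0^z t^{a-1}(1-t)^{b-1}\,dt$ for $a,b>0$, $0\leq z\leq 1$. *)

theory Defs
  imports "HOL-Analysis.Analysis"
begin

(* Non-regularized: B(a,b;1) is Beta a b. Meaningful for a, b > 0 and 0 <= z <= 1, where the
   integrand is absolutely integrable; the convention 0 powr s = 0 only affects the endpoints. *)
definition incomplete_Beta :: "real \<Rightarrow> real \<Rightarrow> real \<Rightarrow> real" where
  "incomplete_Beta a b z = integral {0..z} (\<lambda>t. t powr (a - 1) * (1 - t) powr (b - 1))"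

end

theory Submission
  imports Defs
begin

text \<open>
  The spheres bounding the two balls meet in a sphere lying in a hyperplane orthogonal to the line
  of centres, at signed distance \<open>h1\<close> from \<open>c1\<close> (measured towards \<open>c2\<close>) and \<open>h2 = d - h1\<close>
  from \<open>c2\<close> (measured towards \<open>c1\<close>). On the far side of this hyperplane, seen from \<open>c1\<close>, being in
  the first ball implies being in the second, and on the near side it is the other way round. So the
  intersection is the union of one cap of each ball, and the two caps overlap only inside the
  hyperplane, which is a null set (\<open>cball_Int_cball_eq_Un_caps\<close>).

  It remains to find the volume of the cap of height \<open>r - h\<close> of a ball of radius \<open>r\<close> in dimension
  \<open>n\<close>. Its slice at signed distance \<open>y\<close> from the centre is an \<open>(n-1)\<close>-dimensional ball of radius
  \<open>sqrt (r\<^sup>2 - y\<^sup>2)\<close>, so by Fubini the volume is the volume of the \<open>(n-1)\<close>-dimensional unit ball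
  times the integral of \<open>sqrt (r\<^sup>2 - y\<^sup>2) ^ (n - 1)\<close> over \<open>h \<le> y \<le> r\<close> (\<open>emeasure_PiM_cap\<close>). The
  substitution \<open>y = r * (1 - 2 * t)\<close> turns \<open>r\<^sup>2 - y\<^sup>2\<close> into \<open>4 * r\<^sup>2 * t * (1 - t)\<close> and the
  integral into an incomplete beta function
  (\<open>nn_integral_sqrt_power_eq_incomplete_Beta\<close>).

  Slicing with the product measure handles caps whose axis is a coordinate direction. An arbitrary
  axis is rotated to such a direction, which requires that orthogonal maps preserve Lebesgue
  measure. This is proved by the uniqueness argument for Haar measure, comparing the Lebesgue measure
  with its image under the map and normalising on the unit ball, which the map fixes
  (\<open>emeasure_lborel_vimage_orthogonal\<close>).
\<close>

section \<open>Invariance of Lebesgue measure under orthogonal maps\<close>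

lemma nn_integral_lborel_translate:
  fixes g :: "'a::euclidean_space \<Rightarrow> ennreal"
  assumes [measurable]: "g \<in> borel_measurable borel"
  shows "(\<integral>\<^sup>+x. g (a + x) \<partial>lborel) = (\<integral>\<^sup>+x. g x \<partial>lborel)"
  by (subst (2) lborel_distr_plus[of a, symmetric]) (simp add: nn_integral_distr)

lemma nn_integral_lborel_reflect:
  fixes g :: "'a::euclidean_space \<Rightarrow> ennreal"
  assumes [measurable]: "g \<in> borel_measurable borel"
  shows "(\<integral>\<^sup>+x. g (a - x) \<partial>lborel) = (\<integral>\<^sup>+x. g x \<partial>lborel)"
proof -
  have "(lborel :: 'a measure) = distr lborel borel (\<lambda>x. a - x)"
    using lborel_affine[of "-1" a] by (simp add: density_1)
  then have "(\<integral>\<^sup>+x. g x \<partial>lborel) = (\<integral>\<^sup>+x. g x \<partial>distr lborel borel (\<lambda>x. a - x))"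
    by simp
  then show ?thesis
    by (simp add: nn_integral_distr)
qed

text \<open>
  Write \<open>L\<close> for Lebesgue measure and \<open>B\<close> for the unit ball, and evaluate
  \<open>\<integral>\<integral> 1\<^sub>A(f x) 1\<^sub>B(f x + y) dx dy\<close> in two ways. Integrating over \<open>y\<close> first gives
  \<open>L(f -` A) * L(B)\<close> by translation invariance. Replacing \<open>x\<close> by \<open>x - f\<^sup>-\<^sup>1 y\<close> first and then
  integrating over \<open>y\<close> gives \<open>L(A) * L(f -` B) = L(A) * L(B)\<close>, by invariance under translations
  and the point reflection. Since \<open>L(B)\<close> is positive and finite, it cancels.
\<close>

lemma emeasure_lborel_vimage_orthogonal:
  fixes f :: "'a::euclidean_space \<Rightarrow> 'a"
  assumes f: "orthogonal_transformation f" and A: "A \<in> sets borel"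
  shows "emeasure lborel (f -` A) = emeasure lborel A"
proof -
  define B :: "'a set" where "B = ball 0 1"
  have lin: "linear f" and surj: "surj f"
    using f by (auto simp: orthogonal_transformation_linear orthogonal_transformation_surj)
  have [measurable]: "f \<in> borel_measurable borel"
    using lin by (intro borel_measurable_continuous_onI linear_continuous_on)
      (simp add: linear_conv_bounded_linear)
  have [measurable]: "A \<in> sets borel" "B \<in> sets borel"
    using A by (auto simp: B_def)
  have nn_integral_indicator_f: "(\<integral>\<^sup>+x. indicator C (f x) \<partial>lborel) = emeasure lborel (f -` C)"
    if [measurable]: "C \<in> sets borel" for C
  proof -
    have "f -` C \<in> sets lborel"
      using measurable_sets_borel[of f borel C] by simp
    moreover have "indicator C (f x) = (indicator (f -` C) x :: ennreal)" for x
      by (simp add: indicator_def)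
    ultimately show ?thesis
      by simp
  qed
  have vimage_B: "f -` B = B"
    using f by (auto simp: B_def orthogonal_transformation_norm)
  have shift: "(\<integral>\<^sup>+x. indicator A (f x) * indicator B (f x + y) \<partial>lborel)
      = (\<integral>\<^sup>+x. indicator A (f x - y) * indicator B (f x) \<partial>lborel)" for y
  proof -
    obtain z where z: "f z = y"
      using surj by (metis surjD)
    have "(\<integral>\<^sup>+x. indicator A (f x) * indicator B (f x + y) \<partial>lborel)
      = (\<integral>\<^sup>+x. indicator A (f (- z + x)) * indicator B (f (- z + x) + y) \<partial>lborel)"
      by (rule nn_integral_lborel_translate[symmetric]) measurable
    then show ?thesis
      using z lin by (simp add: linear_diff)
  qed
  have "emeasure lborel (f -` A) * emeasure lborel B =
      (\<integral>\<^sup>+x. indicator A (f x) * emeasure lborel B \<partial>lborel)"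
    by (subst nn_integral_multc) (simp_all add: nn_integral_indicator_f)
  also have "\<dots> = (\<integral>\<^sup>+x. \<integral>\<^sup>+y. indicator A (f x) * indicator B (f x + y) \<partial>lborel \<partial>lborel)"
    by (subst nn_integral_cmult) (simp_all add: nn_integral_lborel_translate)
  also have "\<dots> = (\<integral>\<^sup>+y. \<integral>\<^sup>+x. indicator A (f x) * indicator B (f x + y) \<partial>lborel \<partial>lborel)"
    by (rule lborel_pair.Fubini') measurable
  also have "\<dots> = (\<integral>\<^sup>+y. \<integral>\<^sup>+x. indicator A (f x - y) * indicator B (f x) \<partial>lborel \<partial>lborel)"
    by (simp add: shift)
  also have "\<dots> = (\<integral>\<^sup>+x. \<integral>\<^sup>+y. indicator A (f x - y) * indicator B (f x) \<partial>lborel \<partial>lborel)"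
    by (rule lborel_pair.Fubini') measurable
  also have "\<dots> = (\<integral>\<^sup>+x. emeasure lborel A * indicator B (f x) \<partial>lborel)"
    by (subst nn_integral_multc) (simp_all add: nn_integral_lborel_reflect)
  also have "\<dots> = emeasure lborel A * emeasure lborel (f -` B)"
    by (subst nn_integral_cmult) (simp_all add: nn_integral_indicator_f)
  finally have eq: "emeasure lborel (f -` A) * emeasure lborel B = emeasure lborel A * emeasure lborel B"
    by (simp add: vimage_B)
  have "emeasure lborel B \<noteq> 0" "emeasure lborel B \<noteq> \<infinity>"
    by (simp_all add: B_def emeasure_ball unit_ball_vol_pos[THEN less_imp_neq, symmetric])
  with eq show ?thesis
    by (metis ennreal_mult_divide_eq infinity_ennreal_def)
qed

section \<open>The volume of a spherical cap\<close>

text \<open>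
  For a unit vector \<open>u\<close>, the offset \<open>h\<close> is the signed distance of the cutting hyperplane from the
  centre, so a cap with \<open>h < 0\<close> is larger than a half-ball; this happens when the centres of two
  intersecting balls lie on the same side of the hyperplane. The cap is closed so that two
  complementary caps cover the closed ball.
\<close>

definition spherical_cap :: "'a::euclidean_space \<Rightarrow> real \<Rightarrow> 'a \<Rightarrow> real \<Rightarrow> 'a set" where
  "spherical_cap c r u h = {x \<in> cball c r. h \<le> (x - c) \<bullet> u}"

text \<open>
  The substitution \<open>y = r - 2 * r * t\<close> is affine with factor \<open>- (2 * r)\<close> and maps
  \<open>{0..(1 - h / r) / 2}\<close> onto \<open>{h..r}\<close>. Here \<open>m\<close> is the dimension of the slices of a cap; its
  positivity makes the integrand \<open>(t * (1 - t)) powr (m / 2)\<close> continuous up to the endpoints.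
\<close>

lemma nn_integral_sqrt_power_eq_incomplete_Beta:
  fixes r h :: real
  assumes "r > 0" "-r \<le> h" "h \<le> r" "m > 0"
  shows "(\<integral>\<^sup>+y. ennreal (indicator {h..r} y * sqrt (r\<^sup>2 - y\<^sup>2) ^ m) \<partial>lborel) =
    ennreal ((2 * r) ^ Suc m * incomplete_Beta (real m / 2 + 1) (real m / 2 + 1) (1/2 * (1 - h / r)))"
proof -
  define z where "z = 1/2 * (1 - h / r)"
  define g where "g t = t powr (real m / 2) * (1 - t) powr (real m / 2)" for t :: real
  have z: "0 \<le> z" "z \<le> 1"
    using assms by (auto simp: z_def field_simps)
  have "continuous_on {0..z} g"
    unfolding g_def using z assms by (intro continuous_intros continuous_on_powr') auto
  then have "(g has_integral integral {0..z} g) {0..z}"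
    using integrable_continuous_real integrable_integral by blast
  then have int_g: "(\<integral>\<^sup>+t. ennreal (indicator {0..z} t * g t) \<partial>lborel) = ennreal (integral {0..z} g)"
    using nn_integral_has_integral_lebesgue[of "{0..z}" g] by (auto simp: g_def)
  have subst: "indicator {h..r} (r + - (2 * r) * t) * sqrt (r\<^sup>2 - (r + - (2 * r) * t)\<^sup>2) ^ m
      = (2 * r) ^ m * (indicator {0..z} t * g t)" for t :: real
  proof (cases "t \<in> {0..z}")
    case True
    have "r\<^sup>2 - (r + - (2 * r) * t)\<^sup>2 = (2 * r)\<^sup>2 * (t * (1 - t))"
      by (simp add: power2_eq_square algebra_simps)
    moreover have "sqrt (t * (1 - t)) ^ m = g t"
    proof -
      have nn: "0 \<le> t" "0 \<le> 1 - t"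
        using True z by auto
      have "sqrt s ^ m = s powr (real m / 2)" if "0 \<le> s" for s
        using that \<open>m > 0\<close> by (simp add: powr_half_sqrt[symmetric] powr_realpow' [symmetric] powr_powr)
      then show ?thesis
        using nn by (simp add: g_def real_sqrt_mult power_mult_distrib)
    qed
    moreover have "r + - (2 * r) * t \<in> {h..r}"
      using True assms by (auto simp: z_def field_simps)
    ultimately show ?thesis
      using True assms by (simp add: real_sqrt_mult power_mult_distrib)
  next
    case False
    then have "r + - (2 * r) * t \<notin> {h..r}"
      using assms by (auto simp: z_def field_simps zero_le_mult_iff)
    with False show ?thesis
      by simp
  qed
  have "(\<integral>\<^sup>+y. ennreal (indicator {h..r} y * sqrt (r\<^sup>2 - y\<^sup>2) ^ m) \<partial>lborel) =
      ennreal (2 * r) * (\<integral>\<^sup>+t. ennreal ((2 * r) ^ m * (indicator {0..z} t * g t)) \<partial>lborel)"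
    using \<open>r > 0\<close>
    by (subst nn_integral_real_affine[where c = "- (2 * r)" and t = r])
       (simp_all only: subst, auto)
  also have "(\<integral>\<^sup>+t. ennreal ((2 * r) ^ m * (indicator {0..z} t * g t)) \<partial>lborel)
      = ennreal ((2 * r) ^ m) * ennreal (integral {0..z} g)"
    using \<open>r > 0\<close> by (simp add: ennreal_mult' g_def nn_integral_cmult flip: int_g)
  also have "ennreal (2 * r) * \<dots> = ennreal ((2 * r) ^ Suc m * integral {0..z} g)"
    using \<open>r > 0\<close> by (simp add: ennreal_mult' flip: mult.assoc)
  finally show ?thesis
    by (simp add: incomplete_Beta_def g_def[abs_def] z_def)
qed

text \<open>
  Fubini along the coordinate \<open>i\<close>: the slice at \<open>f i = y\<close> is a ball of radius
  \<open>sqrt (r\<^sup>2 - y\<^sup>2)\<close> in the remaining coordinates, of which \<open>emeasure_cball_aux\<close> gives the measure.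
  Working in a product over an index set lets the dimension drop by one, which the dimension of a
  Euclidean space type cannot do.
\<close>

lemma emeasure_PiM_cap:
  assumes "finite A" "i \<notin> A" "r > 0" "- r \<le> h"
  shows "emeasure (Pi\<^sub>M (insert i A) (\<lambda>_. lborel))
      ({f. sqrt (\<Sum>j\<in>insert i A. (f j)\<^sup>2) \<le> r \<and> h \<le> f i} \<inter> space (Pi\<^sub>M (insert i A) (\<lambda>_. lborel))) =
    ennreal (unit_ball_vol (card A)) *
      (\<integral>\<^sup>+y. ennreal (indicator {h..r} y * sqrt (r\<^sup>2 - y\<^sup>2) ^ card A) \<partial>lborel)"
proof -
  interpret product_sigma_finite "\<lambda>_. lborel"
    by standard
  let ?P = "Pi\<^sub>M A (\<lambda>_. lborel :: real measure)"
  let ?S = "{f. sqrt (\<Sum>j\<in>insert i A. (f j)\<^sup>2) \<le> r \<and> h \<le> f i} \<inter> space (Pi\<^sub>M (insert i A) (\<lambda>_. lborel))"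
  let ?D = "\<lambda>s. {f. sqrt (\<Sum>j\<in>A. (f j)\<^sup>2) \<le> s} \<inter> space ?P"
  have slice: "indicator ?S (f(i := y)) = (indicator {h..r} y * indicator (?D (sqrt (r\<^sup>2 - y\<^sup>2))) f :: ennreal)"
    if "f \<in> space ?P" for f y
  proof -
    define s where "s = (\<Sum>j\<in>A. (f j)\<^sup>2)"
    have "s \<ge> 0"
      by (simp add: s_def sum_nonneg)
    have "(\<Sum>j\<in>A. ((f(i := y)) j)\<^sup>2) = s"
      unfolding s_def using assms by (intro sum.cong) auto
    moreover have "f(i := y) \<in> space (Pi\<^sub>M (insert i A) (\<lambda>_. lborel))"
      using that by (simp add: space_PiM PiE_def extensional_def)
    ultimately have "f(i := y) \<in> ?S \<longleftrightarrow> sqrt (y\<^sup>2 + s) \<le> r \<and> h \<le> y"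
      using assms(1,2) by simp
    also have "sqrt (y\<^sup>2 + s) \<le> r \<longleftrightarrow> y\<^sup>2 + s \<le> r\<^sup>2"
      using assms \<open>s \<ge> 0\<close> by (simp add: real_sqrt_le_iff')
    also have "(y\<^sup>2 + s \<le> r\<^sup>2 \<and> h \<le> y) \<longleftrightarrow> y \<in> {h..r} \<and> s \<le> r\<^sup>2 - y\<^sup>2"
    proof -
      have "y \<le> r" if "y\<^sup>2 + s \<le> r\<^sup>2"
        by (rule power2_le_imp_le) (use that \<open>s \<ge> 0\<close> \<open>r > 0\<close> in linarith)+
      then show ?thesis
        unfolding atLeastAtMost_iff by linarith
    qed
    also have "s \<le> r\<^sup>2 - y\<^sup>2 \<longleftrightarrow> sqrt s \<le> sqrt (r\<^sup>2 - y\<^sup>2)"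
      by simp
    also have "sqrt s \<le> sqrt (r\<^sup>2 - y\<^sup>2) \<longleftrightarrow> f \<in> ?D (sqrt (r\<^sup>2 - y\<^sup>2))"
      using that by (simp add: s_def)
    finally show ?thesis
      unfolding indicator_def by (simp only: of_bool_conj)
  qed
  have "emeasure (Pi\<^sub>M (insert i A) (\<lambda>_. lborel)) ?S
      = (\<integral>\<^sup>+f. indicator ?S f \<partial>Pi\<^sub>M (insert i A) (\<lambda>_. lborel))"
    using \<open>finite A\<close> by (subst nn_integral_indicator) auto
  also have "\<dots> = (\<integral>\<^sup>+y. \<integral>\<^sup>+f. indicator ?S (f(i := y)) \<partial>?P \<partial>lborel)"
    using assms by (subst product_nn_integral_insert_rev) auto
  also have "\<dots> = (\<integral>\<^sup>+y. \<integral>\<^sup>+f. indicator {h..r} y * indicator (?D (sqrt (r\<^sup>2 - y\<^sup>2))) f \<partial>?P \<partial>lborel)"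
    by (intro nn_integral_cong slice)
  also have "\<dots> = (\<integral>\<^sup>+y. indicator {h..r} y * emeasure ?P (?D (sqrt (r\<^sup>2 - y\<^sup>2))) \<partial>lborel)"
    using \<open>finite A\<close> by (simp add: nn_integral_cmult)
  also have "\<dots> = (\<integral>\<^sup>+y. ennreal (unit_ball_vol (card A)) *
      ennreal (indicator {h..r} y * sqrt (r\<^sup>2 - y\<^sup>2) ^ card A) \<partial>lborel)"
  proof (intro nn_integral_cong_AE)
    \<comment> \<open>At these two heights the slice is a ball of radius \<open>0\<close>, to which the volume formula for
      positive radii does not apply.\<close>
    have "AE y in lborel. y \<notin> {-r, r}"
      by (intro AE_not_in countable_imp_null_set_lborel) auto
    then show "AE y in lborel. indicator {h..r} y * emeasure ?P (?D (sqrt (r\<^sup>2 - y\<^sup>2))) =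
        ennreal (unit_ball_vol (card A)) * ennreal (indicator {h..r} y * sqrt (r\<^sup>2 - y\<^sup>2) ^ card A)"
    proof eventually_elim
      case (elim y)
      show ?case
      proof (cases "y \<in> {h..r}")
        case True
        have "\<bar>y\<bar>\<^sup>2 < r\<^sup>2"
          using True elim assms by (intro power_strict_mono) auto
        then have "y\<^sup>2 < r\<^sup>2"
          by simp
        then show ?thesis
          using emeasure_cball_aux[OF \<open>finite A\<close>, of "sqrt (r\<^sup>2 - y\<^sup>2)"] True
          by (simp add: ennreal_mult')
      qed simp
    qed
  qed
  also have "\<dots> = ennreal (unit_ball_vol (card A)) *
      (\<integral>\<^sup>+y. ennreal (indicator {h..r} y * sqrt (r\<^sup>2 - y\<^sup>2) ^ card A) \<partial>lborel)"
    by (rule nn_integral_cmult) measurable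
  finally show ?thesis .
qed

lemma closed_spherical_cap: "closed (spherical_cap c r u h)"
proof -
  have "closed {x. h \<le> (x - c) \<bullet> u}"
    by (intro closed_Collect_le continuous_intros)
  moreover have "spherical_cap c r u h = cball c r \<inter> {x. h \<le> (x - c) \<bullet> u}"
    by (auto simp: spherical_cap_def)
  ultimately show ?thesis
    by (simp add: closed_Int)
qed

lemma lmeasurable_spherical_cap: "spherical_cap c r u h \<in> lmeasurable"
proof (rule lmeasurable_compact)
  have "bounded (spherical_cap c r u h)"
    by (rule bounded_subset[of "cball c r"]) (auto simp: spherical_cap_def)
  then show "compact (spherical_cap c r u h)"
    by (simp add: compact_eq_bounded_closed closed_spherical_cap)
qed

lemma emeasure_spherical_cap_Basis:
  fixes b :: "'a::euclidean_space"
  assumes "b \<in> Basis" "r > 0" "- r \<le> h" "h \<le> r" "DIM('a) \<ge> 2"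
  shows "emeasure lborel (spherical_cap 0 r b h) = ennreal (unit_ball_vol (real DIM('a) - 1) *
    ((2 * r) ^ DIM('a) *
      incomplete_Beta ((real DIM('a) + 1) / 2) ((real DIM('a) + 1) / 2) (1/2 * (1 - h / r))))"
proof -
  let ?A = "Basis - {b} :: 'a set"
  let ?P = "Pi\<^sub>M Basis (\<lambda>_. lborel) :: ('a \<Rightarrow> real) measure"
  have A: "insert b ?A = Basis" "finite ?A" "b \<notin> ?A" "card ?A = DIM('a) - 1"
    using assms by auto
  have norm_eq: "norm (\<Sum>b\<in>Basis. f b *\<^sub>R b :: 'a) = sqrt (\<Sum>j\<in>Basis. (f j)\<^sup>2)" for f
    by (subst norm_eq_sqrt_inner, subst euclidean_inner) (simp add: power2_eq_square)
  have "emeasure lborel (spherical_cap 0 r b h) =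
      emeasure (distr ?P borel (\<lambda>f. \<Sum>b\<in>Basis. f b *\<^sub>R b)) (spherical_cap 0 r b h)"
    by (subst lborel_eq) simp
  also have "\<dots> = emeasure ?P
      ((\<lambda>f. \<Sum>b\<in>Basis. f b *\<^sub>R b) -` spherical_cap 0 r b h \<inter> space ?P)"
    by (subst emeasure_distr) (auto intro: borel_closed closed_spherical_cap)
  also have "(\<lambda>f. \<Sum>b\<in>Basis. f b *\<^sub>R b) -` spherical_cap 0 r b h =
      {f. sqrt (\<Sum>j\<in>Basis. (f j)\<^sup>2) \<le> r \<and> h \<le> f b}"
    using assms by (auto simp: spherical_cap_def norm_eq)
  also have "emeasure ?P (\<dots> \<inter> space ?P) = ennreal (unit_ball_vol (card ?A)) *
      (\<integral>\<^sup>+y. ennreal (indicator {h..r} y * sqrt (r\<^sup>2 - y\<^sup>2) ^ card ?A) \<partial>lborel)"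
    using emeasure_PiM_cap[of ?A b r h] assms A by simp
  also have "\<dots> = ennreal (unit_ball_vol (card ?A)) * ennreal ((2 * r) ^ Suc (card ?A) *
      incomplete_Beta (real (card ?A) / 2 + 1) (real (card ?A) / 2 + 1) (1/2 * (1 - h / r)))"
    using assms A by (subst nn_integral_sqrt_power_eq_incomplete_Beta) auto
  also have "real (card ?A) = real DIM('a) - 1"
    using assms A by (simp add: of_nat_diff)
  also have "Suc (card ?A) = DIM('a)"
    using assms A by simp
  also have "(real DIM('a) - 1) / 2 + 1 = (real DIM('a) + 1) / 2"
    by (simp add: field_simps)
  finally show ?thesis
    using assms by (subst ennreal_mult') auto
qed

lemma measure_spherical_cap:
  fixes c u :: "real ^ 'n"
  assumes "norm u = 1" "r > 0" "- r \<le> h" "h \<le> r" "CARD('n) \<ge> 2"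
  shows "measure lebesgue (spherical_cap c r u h) = unit_ball_vol (real CARD('n) - 1) *
    ((2 * r) ^ CARD('n) *
      incomplete_Beta ((real CARD('n) + 1) / 2) ((real CARD('n) + 1) / 2) (1/2 * (1 - h / r)))"
proof -
  obtain b :: "real ^ 'n" where b: "b \<in> Basis"
    using nonempty_Basis by blast
  then have "norm u = norm b"
    using assms by simp
  then obtain f where f: "orthogonal_transformation f" "f u = b"
    using orthogonal_transformation_exists by blast
  have "f -` spherical_cap 0 r b h = spherical_cap 0 r u h"
    using f by (auto simp: spherical_cap_def orthogonal_transformation_norm orthogonal_transformation_def)
  then have rot: "emeasure lborel (spherical_cap 0 r u h) = emeasure lborel (spherical_cap 0 r b h)"
    using emeasure_lborel_vimage_orthogonal[OF f(1)] by (metis borel_closed closed_spherical_cap)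
  have "spherical_cap c r u h = (+) c ` spherical_cap 0 r u h"
  proof (intro equalityI subsetI)
    fix x assume "x \<in> spherical_cap c r u h"
    then have "x - c \<in> spherical_cap 0 r u h"
      by (auto simp: spherical_cap_def dist_norm norm_minus_commute)
    then show "x \<in> (+) c ` spherical_cap 0 r u h"
      by (auto intro: image_eqI[of _ _ "x - c"])
  qed (auto simp: spherical_cap_def dist_norm)
  then have "measure lebesgue (spherical_cap c r u h) = measure lebesgue (spherical_cap 0 r u h)"
    by (simp add: measure_translation)
  also have "\<dots> = measure lborel (spherical_cap 0 r u h)"
    by (simp add: borel_closed closed_spherical_cap)
  also have "\<dots> = measure lborel (spherical_cap 0 r b h)"
    using rot by (simp add: measure_def)
  also have "\<dots> = unit_ball_vol (real CARD('n) - 1) * ((2 * r) ^ CARD('n) *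
      incomplete_Beta ((real CARD('n) + 1) / 2) ((real CARD('n) + 1) / 2) (1/2 * (1 - h / r)))"
  proof -
    \<comment> \<open>Without nonnegativity, \<open>ennreal\<close> would truncate the value to \<open>0\<close>.\<close>
    have "0 \<le> incomplete_Beta p p z" for p z
      unfolding incomplete_Beta_def
      by (cases "(\<lambda>t. t powr (p - 1) * (1 - t) powr (p - 1)) integrable_on {0..z}")
        (auto intro: integral_nonneg simp: not_integrable_integral)
    then show ?thesis
      using emeasure_spherical_cap_Basis[OF b, of r h] assms
      by (simp add: measure_def enn2real_ennreal)
  qed
  finally show ?thesis .
qed

section \<open>Splitting the intersection of two balls\<close>

text \<open>
  Put \<open>t = (x - c1) \<bullet> u\<close>. The powers of \<open>x\<close> with respect to the two spheres,
  \<open>(dist ci x)\<^sup>2 - ri\<^sup>2\<close>, differ by \<open>2 * d * (h1 - t)\<close>. So the larger of the two, whose sign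
  decides membership in the intersection, is the one belonging to \<open>c1\<close> when \<open>t \<ge> h1\<close> and the one
  belonging to \<open>c2\<close> when \<open>t \<le> h1\<close>; the latter condition reads \<open>(x - c2) \<bullet> (- u) \<ge> h2\<close>, as
  \<open>h1 + h2 = d\<close>.
\<close>

lemma cball_Int_cball_eq_Un_caps:
  fixes c1 c2 :: "'a::euclidean_space"
  assumes d: "d = dist c1 c2" "d > 0"
    and u: "u = (c2 - c1) /\<^sub>R d"
    and h1: "h1 = (r1\<^sup>2 - r2\<^sup>2 + d\<^sup>2) / (2 * d)"
    and h2: "h2 = (r2\<^sup>2 - r1\<^sup>2 + d\<^sup>2) / (2 * d)"
    and r: "r1 > 0" "r2 > 0"
  shows "cball c1 r1 \<inter> cball c2 r2 = spherical_cap c1 r1 u h1 \<union> spherical_cap c2 r2 (- u) h2"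
    and "spherical_cap c1 r1 u h1 \<inter> spherical_cap c2 r2 (- u) h2 \<subseteq> {x. u \<bullet> x = h1 + u \<bullet> c1}"
proof -
  have c2: "c2 = c1 + d *\<^sub>R u"
    using d u by simp
  have uu: "u \<bullet> u = 1"
    using d u by (simp add: dist_norm norm_minus_commute dot_square_norm power2_eq_square)
  have h12: "h1 + h2 = d"
    using d by (simp add: h1 h2 field_simps power2_eq_square)
  have height: "(x - c2) \<bullet> (- u) = d - (x - c1) \<bullet> u" for x
    using uu by (simp add: c2 algebra_simps inner_simps)
  have dist2: "(dist c2 x)\<^sup>2 - r2\<^sup>2 = (dist c1 x)\<^sup>2 - r1\<^sup>2 + 2 * d * (h1 - (x - c1) \<bullet> u)" for x
  proof -
    have "2 * d * h1 = r1\<^sup>2 - r2\<^sup>2 + d\<^sup>2"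
      using d by (simp add: h1)
    moreover have "(dist c2 x)\<^sup>2 = (dist c1 x)\<^sup>2 - 2 * d * ((x - c1) \<bullet> u) + d\<^sup>2"
      using uu by (simp add: c2 dist_commute[of _ x] dist_norm power2_norm_eq_inner inner_simps)
        (simp add: power2_eq_square inner_commute algebra_simps)
    ultimately show ?thesis
      by (simp add: algebra_simps)
  qed
  have mem: "x \<in> cball c1 r1 \<longleftrightarrow> (dist c1 x)\<^sup>2 - r1\<^sup>2 \<le> 0" "x \<in> cball c2 r2 \<longleftrightarrow> (dist c2 x)\<^sup>2 - r2\<^sup>2 \<le> 0" for x
    using r by (auto simp: power_mono_iff)
  have sgn: "0 \<le> 2 * d * t \<longleftrightarrow> 0 \<le> t" "2 * d * t \<le> 0 \<longleftrightarrow> t \<le> 0" for t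
    using d by (auto simp: zero_le_mult_iff mult_le_0_iff)
  show "cball c1 r1 \<inter> cball c2 r2 = spherical_cap c1 r1 u h1 \<union> spherical_cap c2 r2 (- u) h2"
  proof (rule set_eqI)
    fix x
    show "x \<in> cball c1 r1 \<inter> cball c2 r2 \<longleftrightarrow> x \<in> spherical_cap c1 r1 u h1 \<union> spherical_cap c2 r2 (- u) h2"
      unfolding spherical_cap_def Un_iff Int_iff mem_Collect_eq height mem
      using dist2[of x] sgn[of "h1 - (x - c1) \<bullet> u"] h12 by linarith
  qed
  show "spherical_cap c1 r1 u h1 \<inter> spherical_cap c2 r2 (- u) h2 \<subseteq> {x. u \<bullet> x = h1 + u \<bullet> c1}"
  proof
    fix x assume "x \<in> spherical_cap c1 r1 u h1 \<inter> spherical_cap c2 r2 (- u) h2"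
    then have "h1 \<le> (x - c1) \<bullet> u" "h2 \<le> d - (x - c1) \<bullet> u"
      unfolding spherical_cap_def Int_iff mem_Collect_eq height by auto
    with h12 have "(x - c1) \<bullet> u = h1"
      by linarith
    then show "x \<in> {x. u \<bullet> x = h1 + u \<bullet> c1}"
      by (simp add: inner_diff_left inner_commute[of u])
  qed
qed

lemma measure_ball_Int_ball:
  fixes c1 c2 :: "'a::euclidean_space"
  shows "measure lebesgue (ball c1 r1 \<inter> ball c2 r2) = measure lebesgue (cball c1 r1 \<inter> cball c2 r2)"
proof (rule measure_negligible_symdiff)
  have "negligible (sphere c1 r1 \<union> sphere c2 r2)"
    by (simp add: negligible_sphere)
  then show "negligible (cball c1 r1 \<inter> cball c2 r2 - ball c1 r1 \<inter> ball c2 r2 \<union>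
      (ball c1 r1 \<inter> ball c2 r2 - cball c1 r1 \<inter> cball c2 r2))"
    by (rule negligible_subset) auto
qed (auto intro: lmeasurable_compact)

text \<open>
  The two bounds are the triangle inequalities \<open>s < r + d\<close> and \<open>\<bar>d - r\<bar> < s\<close>, squared.
\<close>

lemma radical_offset_bounds:
  fixes r s d :: real
  assumes "\<bar>r - s\<bar> < d" "d < r + s" "r > 0"
  shows "- r < (r\<^sup>2 - s\<^sup>2 + d\<^sup>2) / (2 * d)" "(r\<^sup>2 - s\<^sup>2 + d\<^sup>2) / (2 * d) < r"
proof -
  have "d > 0" "s > 0"
    using assms by auto
  have "s\<^sup>2 < (r + d)\<^sup>2"
    using assms \<open>s > 0\<close> by (intro power_strict_mono) auto
  then show "- r < (r\<^sup>2 - s\<^sup>2 + d\<^sup>2) / (2 * d)"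
    using \<open>d > 0\<close> by (simp add: field_simps power2_eq_square)
  have "\<bar>d - r\<bar>\<^sup>2 < s\<^sup>2"
    using assms by (intro power_strict_mono) auto
  then have "(d - r)\<^sup>2 < s\<^sup>2"
    by simp
  then show "(r\<^sup>2 - s\<^sup>2 + d\<^sup>2) / (2 * d) < r"
    using \<open>d > 0\<close> by (simp add: field_simps power2_eq_square)
qed

section \<open>The volume of the intersection\<close>

theorem theorem2:
  fixes c1 c2 :: "real ^ 'n" and r1 r2 d h1 h2 :: real
  assumes "CARD('n) \<ge> 2"
    and "r1 > 0" and "r2 > 0"
    and "d = dist c1 c2"
    and "\<bar>r1 - r2\<bar> < d" and "d < r1 + r2"
    and "h1 = (r1\<^sup>2 - r2\<^sup>2 + d\<^sup>2) / (2 * d)"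
    and "h2 = (r2\<^sup>2 - r1\<^sup>2 + d\<^sup>2) / (2 * d)"
  shows "measure lebesgue (ball c1 r1 \<inter> ball c2 r2) =
           2 ^ CARD('n) * pi powr ((real CARD('n) - 1) / 2) / Gamma ((real CARD('n) + 1) / 2) *
           (r1 ^ CARD('n) *
              incomplete_Beta ((real CARD('n) + 1) / 2) ((real CARD('n) + 1) / 2)
                (1 / 2 * (1 - h1 / r1)) +
            r2 ^ CARD('n) *
              incomplete_Beta ((real CARD('n) + 1) / 2) ((real CARD('n) + 1) / 2)
                (1 / 2 * (1 - h2 / r2)))
         \<and> - r1 < h1 \<and> h1 < r1 \<and> - r2 < h2 \<and> h2 < r2
         \<and> 1 / 2 * (1 - h1 / r1) \<in> {0<..<1} \<and> 1 / 2 * (1 - h2 / r2) \<in> {0<..<1}"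
proof -
  have "d > 0"
    using assms(5) by linarith
  have b1: "- r1 < h1" "h1 < r1"
    unfolding assms(7) using radical_offset_bounds[of r1 r2 d] assms(2,3,5,6) by auto
  have b2: "- r2 < h2" "h2 < r2"
    unfolding assms(8) using radical_offset_bounds[of r2 r1 d] assms(2,3,5,6) by auto
  define u where "u = (c2 - c1) /\<^sub>R d"
  have u: "norm u = 1"
    using \<open>d > 0\<close> assms(4) by (simp add: u_def dist_norm norm_minus_commute)
  note caps = cball_Int_cball_eq_Un_caps[OF assms(4) \<open>d > 0\<close> u_def assms(7,8,2,3)]
  have "negligible (spherical_cap c1 r1 u h1 \<inter> spherical_cap c2 r2 (- u) h2)"
    using u by (intro negligible_subset[OF negligible_hyperplane caps(2)]) auto
  then have "measure lebesgue (ball c1 r1 \<inter> ball c2 r2) =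
      measure lebesgue (spherical_cap c1 r1 u h1) + measure lebesgue (spherical_cap c2 r2 (- u) h2)"
    unfolding measure_ball_Int_ball caps(1)
    by (simp add: measure_Un3 lmeasurable_spherical_cap negligible_imp_measure0)
  also have "\<dots> = 2 ^ CARD('n) * unit_ball_vol (real CARD('n) - 1) *
           (r1 ^ CARD('n) *
              incomplete_Beta ((real CARD('n) + 1) / 2) ((real CARD('n) + 1) / 2)
                (1 / 2 * (1 - h1 / r1)) +
            r2 ^ CARD('n) *
              incomplete_Beta ((real CARD('n) + 1) / 2) ((real CARD('n) + 1) / 2)
                (1 / 2 * (1 - h2 / r2)))"
    using u b1 b2 assms(1-3) by (simp add: measure_spherical_cap power_mult_distrib distrib_left mult_ac)
  also have "unit_ball_vol (real CARD('n) - 1) =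
      pi powr ((real CARD('n) - 1) / 2) / Gamma ((real CARD('n) + 1) / 2)"
    by (simp add: unit_ball_vol_def field_simps)
  finally show ?thesis
    using b1 b2 assms(2,3) by (auto simp: field_simps)
qed

end
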